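(* Let $n\ge1$, $1/2<s<1$, and let $\Omega\subset\mathbb R^n$ be either a ball $B_R=\{|x|<R\}$, $R>0$, or an annulus $A_{R_0,R}=\{R_0<|x|<R\}$, $0<R_0<R$. Let $u\in C^{1,2s+\varepsilon-1}(\Omega)\cap\mathcal L_s$ (for some $\varepsilon>0$) satisfy $$(-\Delta)^su\ge0\ \text{ in }\Omega,\qquad u\ge0\ \text{ in }\Omega,\qquad \mathcal N_su\ge0\ \text{ in }\mathbb R^n\setminus\overline\Omega .$$ Then, either $u>0$ a.e. in $\Omega$ or $u\equiv0$ a.e. in $\Omega$.
   Context: $c_{n,s}>0$ is the normalization constant of the fractional Laplacian $$(-\Delta)^su(x)=c_{n,s}\,\mathrm{PV}\int_{\mathbb R^n}\frac{u(x)-u(y)}{|x-y|^{n+2s}}\,dy .$$ The nonlocal normal derivative is $$\mathcal N_su(x)=c_{n,s}\int_\Omega\frac{u(x)-u(y)}{|x-y|^{n+2s}}\,dy,\qquad x\in\mathbb R^n\setminus\overline\Omega .$$ $\mathcal L_s$ is the set of functions $u:\mathbb R^n\to\mathbb R$ such that $\int_{\mathbb R^n}\frac{|u(x)|}{1+|x|^{n+2s}}\,dx<\infty$. For $u\in C^{1,2s+\varepsilon-1}(\Omega)\cap\mathcal L_s$, $(-\Delta)^su$ is continuous in $\Omega$ and given pointwise by the integral above. *)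

theory Defs
  imports "HOL-Analysis.Analysis"
begin

text \<open>
  The normalization constant for which the Fourier symbol of the fractional Laplacian
  in dimension \<open>n\<close> is \<open>|\<xi>|\<close> to the power \<open>2s\<close>.
\<close>
definition frac_laplacian_const :: "nat \<Rightarrow> real \<Rightarrow> real" where
  "frac_laplacian_const n s =
     4 powr s * s * Gamma (real n / 2 + s) / (pi powr (real n / 2) * Gamma (1 - s))"

lemma frac_laplacian_const_pos:
  assumes "0 < s" "s < 1"
  shows "frac_laplacian_const n s > 0"
  unfolding frac_laplacian_const_def using assms
  by (intro divide_pos_pos mult_pos_pos Gamma_real_pos) auto

text \<open>
  The principal value is the limit of the integrals over the complements of balls shrinking
  to \<open>x\<close>. As \<open>Lim\<close> and the integral are total, this is meaningful only for functions \<open>u\<close> for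
  which the truncated integrals converge and have a limit, as is the case for \<open>x \<in> \<Omega>\<close> and \<open>u\<close> in
  \<open>C1_holder \<Omega> (2 * s + \<epsilon> - 1) \<inter> L_space s\<close> (both defined below), \<open>\<Omega>\<close> open and \<open>\<epsilon> > 0\<close>,
  when \<open>1/2 < s < 1\<close>.
\<close>
definition frac_laplacian :: "real \<Rightarrow> ('a::euclidean_space \<Rightarrow> real) \<Rightarrow> 'a \<Rightarrow> real" where
  "frac_laplacian s u x = frac_laplacian_const DIM('a) s *
     Lim (at_right 0)
       (\<lambda>r. LINT y : - ball x r | lebesgue. (u x - u y) / norm (x - y) powr (real DIM('a) + 2 * s))"

definition nonlocal_normal_deriv ::
    "real \<Rightarrow> 'a set \<Rightarrow> ('a::euclidean_space \<Rightarrow> real) \<Rightarrow> 'a \<Rightarrow> real" where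
  "nonlocal_normal_deriv s \<Omega> u x = frac_laplacian_const DIM('a) s *
     (LINT y : \<Omega> | lebesgue. (u x - u y) / norm (x - y) powr (real DIM('a) + 2 * s))"

text \<open>Integrability of \<open>|u|\<close> against the weight does not give measurability of \<open>u\<close>.\<close>
definition L_space :: "real \<Rightarrow> ('a::euclidean_space \<Rightarrow> real) set" where
  "L_space s = {u. u \<in> borel_measurable lebesgue \<and>
     integrable lebesgue (\<lambda>x. \<bar>u x\<bar> / (1 + norm x powr (real DIM('a) + 2 * s)))}"

text \<open>
  For an open set \<open>\<Omega>\<close>, the space of functions that are continuously differentiable in \<open>\<Omega>\<close> and whose
  gradient is locally Hoelder continuous in \<open>\<Omega>\<close> with exponent \<open>\<alpha>\<close>, that is, Hoelder continuous on
  each compact subset of \<open>\<Omega>\<close>. The functions are defined on the whole space, but nothing is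
  required of them outside \<open>\<Omega>\<close>.
\<close>
definition C1_holder :: "'a set \<Rightarrow> real \<Rightarrow> ('a::euclidean_space \<Rightarrow> real) set" where
  "C1_holder \<Omega> \<alpha> = {u. \<exists>g :: 'a \<Rightarrow> 'a.
     (\<forall>x\<in>\<Omega>. GDERIV u x :> g x) \<and> continuous_on \<Omega> g \<and>
     (\<forall>K. compact K \<and> K \<subseteq> \<Omega> \<longrightarrow>
        (\<exists>C. \<forall>x\<in>K. \<forall>y\<in>K. norm (g x - g y) \<le> C * norm (x - y) powr \<alpha>))}"

definition annulus :: "real \<Rightarrow> real \<Rightarrow> 'a::real_normed_vector set" where
  "annulus R\<^sub>0 R = {x. R\<^sub>0 < norm x \<and> norm x < R}"

end

theory Submission
  imports Defs
begin

text \<open>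
  Outside \<open>closure \<Omega>\<close> the Neumann condition writes \<open>u x\<close>, up to a positive factor, as at least a
  weighted mean of \<open>u\<close> over \<open>\<Omega>\<close>, so \<open>u \<ge> 0\<close> almost everywhere. If \<open>u\<close> vanishes at some
  \<open>x \<in> \<Omega>\<close>, then \<open>x\<close> is a minimum, the gradient vanishes there, and Hoelder continuity of the gradient
  gives \<open>u y \<le> C * norm (x - y) powr (2 * s + \<epsilon>)\<close> near \<open>x\<close>. Hence the kernel integral converges
  absolutely, the fractional Laplacian at \<open>x\<close> is a negative multiple of the integral of the nonnegative
  function \<open>u y / norm (x - y) powr (n + 2 * s)\<close>, and being nonnegative it forces \<open>u = 0\<close> almost
  everywhere in the whole space.
\<close>

section \<open>Integrability of powers of the distance near and away from the singularity\<close>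

text \<open>With \<open>k\<close> the integer part of \<open>- log 2 t\<close>, \<open>t\<close>
  lies between \<open>(1/2) ^ (k+1)\<close> and \<open>(1/2) ^ k\<close>, so \<open>t powr e\<close>
  differs from the power of the dyadic radius by a factor of at most
  \<open>2 powr \<bar>e\<bar>\<close>, whatever the sign of \<open>e\<close>. This serves to
  dominate a radial power by a series of indicators of dyadic balls.\<close>

lemma powr_dyadic_bound:
  fixes t e :: real
  assumes "0 < t" "t < 1"
  obtains k :: nat where "t \<le> (1/2) ^ k" "t powr e \<le> 2 powr \<bar>e\<bar> * 2 powr (- real k * e)"
proof -
  define l where "l = - log 2 t"
  define k where "k = nat \<lfloor>l\<rfloor>"
  have l0: "l > 0" using assms by (simp add: l_def)
  have t: "t = 2 powr (- l)" using assms by (simp add: l_def)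
  have k: "real k \<le> l" "l < real k + 1" using l0 unfolding k_def by linarith+
  have "t \<le> 2 powr (- real k)" using k t by simp
  also have "\<dots> = (1/2) ^ k" by (simp add: powr_minus powr_realpow power_one_over inverse_eq_divide)
  finally have 1: "t \<le> (1/2) ^ k" .
  have "- l * e + real k * e = - ((l - real k) * e)" by (simp add: algebra_simps)
  also have "\<dots> \<le> \<bar>(l - real k) * e\<bar>" by simp
  also have "\<dots> = (l - real k) * \<bar>e\<bar>" using k by (simp add: abs_mult)
  also have "\<dots> \<le> 1 * \<bar>e\<bar>" using k by (intro mult_right_mono) auto
  finally have "- l * e \<le> \<bar>e\<bar> + (- real k * e)" by simp
  then have "2 powr (- l * e) \<le> 2 powr (\<bar>e\<bar> + (- real k * e))" by simp
  then have "t powr e \<le> 2 powr \<bar>e\<bar> * 2 powr (- real k * e)"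
    unfolding t powr_powr powr_add .
  with 1 that show ?thesis by blast
qed

text \<open>The power is dominated by a series of multiples of indicators of the balls of radius
  \<open>(1/2) ^ k\<close>. The volume of such a ball carries the factor
  \<open>((1/2) ^ k) ^ DIM('a)\<close>, so the integrated series is geometric with ratio
  \<open>2 powr (-q) < 1\<close>.\<close>

lemma set_integrable_norm_powr_ball:
  fixes x :: "'a::euclidean_space"
  assumes q: "q > 0"
  shows "set_integrable lebesgue (ball x 1) (\<lambda>y. norm (x - y) powr (q - real DIM('a)))"
proof -
  define n where "n = real DIM('a)"
  define e where "e = q - n"
  define f where "f = (\<lambda>y. indicator (ball x 1) y * norm (x - y) powr e)"
  define c where "c = (\<lambda>k::nat. 2 powr \<bar>e\<bar> * 2 powr (- real k * e))"
  define V where "V = unit_ball_vol n"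
  have V: "V \<ge> 0" by (simp add: V_def n_def)
  have c: "c k \<ge> 0" for k by (simp add: c_def)
  have [measurable]: "ball x 1 \<in> sets lborel" "cball x r \<in> sets lborel" for r by simp_all
  have f: "f \<in> borel_measurable lborel" unfolding f_def by measurable
  \<comment> \<open>A single term of the series suffices for each \<open>y\<close>. At the centre
    nothing is to be shown, since \<open>0 powr e = 0\<close> even for negative
    \<open>e\<close>.\<close>
  have pointwise: "ennreal (norm (f y)) \<le> (\<Sum>k. ennreal (c k) * indicator (cball x ((1/2)^k)) y)" for y
  proof (cases "y \<in> ball x 1 \<and> y \<noteq> x")
    case True
    then have "0 < norm (x - y)" "norm (x - y) < 1" by (auto simp: dist_norm)
    from powr_dyadic_bound[OF this, of e] obtain k where
      k: "norm (x - y) \<le> (1/2)^k" "norm (x - y) powr e \<le> c k" unfolding c_def by blast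
    have "ennreal (norm (f y)) \<le> ennreal (c k) * indicator (cball x ((1/2)^k)) y"
      using True k by (simp add: f_def dist_norm ennreal_leI)
    also have "\<dots> = (\<Sum>i\<in>{k}. ennreal (c i) * indicator (cball x ((1/2)^i)) y)"
      by (subst sum.insert) auto
    also have "\<dots> \<le> (\<Sum>k. ennreal (c k) * indicator (cball x ((1/2)^k)) y)"
      by (rule sum_le_suminf) auto
    finally show ?thesis .
  qed (auto simp: f_def)
  have vol: "c k * (V * ((1/2)^k) ^ DIM('a)) = 2 powr \<bar>e\<bar> * V * (2 powr (-q)) ^ k" for k
  proof -
    have "((1/2::real)^k) ^ DIM('a) = 2 powr (- real k * n)"
      by (simp add: n_def powr_minus powr_powr power_one_over inverse_eq_divide
          flip: powr_realpow power_mult of_nat_mult)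
    moreover have "(2 powr (-q)) ^ k = 2 powr (- real k * q)"
      by (simp add: powr_powr mult.commute flip: powr_realpow)
    moreover have "2 powr (- real k * e) * 2 powr (- real k * n) = 2 powr (- real k * q)"
      by (simp add: e_def algebra_simps flip: powr_add)
    ultimately show ?thesis by (simp add: c_def mult_ac)
  qed
  have "(\<integral>\<^sup>+ y. ennreal (norm (f y)) \<partial>lborel)
      \<le> (\<integral>\<^sup>+ y. (\<Sum>k. ennreal (c k) * indicator (cball x ((1/2)^k)) y) \<partial>lborel)"
    by (intro nn_integral_mono pointwise)
  also have "\<dots> = (\<Sum>k. \<integral>\<^sup>+ y. ennreal (c k) * indicator (cball x ((1/2)^k)) y \<partial>lborel)"
    by (intro nn_integral_suminf) measurable
  also have "\<dots> = (\<Sum>k. ennreal (c k) * emeasure lborel (cball x ((1/2)^k)))"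
    by (simp add: nn_integral_cmult_indicator)
  also have "\<dots> = (\<Sum>k. ennreal (2 powr \<bar>e\<bar> * V * (2 powr (-q)) ^ k))"
    unfolding vol[symmetric] ennreal_mult'[OF c]
    by (subst emeasure_cball) (simp_all add: V_def n_def)
  also have "\<dots> < \<infinity>"
  proof -
    have "2 powr (-q) < (1::real)" using q by (simp add: powr_less_one)
    then have "summable (\<lambda>k. 2 powr \<bar>e\<bar> * V * (2 powr (-q)) ^ k)"
      by (intro summable_mult summable_geometric) simp
    then have "(\<Sum>k. ennreal (2 powr \<bar>e\<bar> * V * (2 powr (-q)) ^ k)) \<noteq> top"
      using V by (intro ennreal_suminf_neq_top) auto
    then show ?thesis by (simp only: less_top infinity_ennreal_def)
  qed
  finally have "integrable lborel f" using f by (intro integrableI_bounded) auto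
  then have "integrable lebesgue f" using f by (subst integrable_completion) auto
  then show ?thesis by (simp add: set_integrable_def f_def e_def n_def)
qed

text \<open>At distance at least \<open>r\<close> from \<open>x\<close>, both 1 and
  \<open>norm x\<close> are at most multiples of \<open>norm (x - y)\<close>, with factors
  \<open>1 / r\<close> and \<open>norm x / r\<close>. Hence the weight of \<open>L_space\<close>
  controls the kernel there.\<close>

lemma one_plus_norm_powr_le:
  fixes x y :: "'a::real_normed_vector"
  assumes r: "r > 0" and p: "p \<ge> 0" and xy: "r \<le> norm (x - y)"
  shows "1 + norm y powr p \<le> (1 / r powr p + (1 + norm x / r) powr p) * norm (x - y) powr p"
proof -
  have "norm y \<le> norm (x - y) + norm x" by (metis norm_minus_commute norm_triangle_sub add.commute)
  also have "norm x \<le> norm x / r * norm (x - y)"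
    using mult_left_mono[OF xy norm_ge_zero[of x]] r by (simp add: field_simps)
  finally have "norm y \<le> (1 + norm x / r) * norm (x - y)" by (simp add: algebra_simps)
  then have "norm y powr p \<le> ((1 + norm x / r) * norm (x - y)) powr p"
    using p by (intro powr_mono2) auto
  also have "\<dots> = (1 + norm x / r) powr p * norm (x - y) powr p"
    by (rule powr_mult)
  finally have 1: "norm y powr p \<le> (1 + norm x / r) powr p * norm (x - y) powr p" .
  have "r powr p \<le> norm (x - y) powr p" using r p xy by (intro powr_mono2) auto
  then have 2: "1 \<le> 1 / r powr p * norm (x - y) powr p" using r by (simp add: field_simps)
  from 1 2 show ?thesis by (simp add: algebra_simps)
qed

lemma set_integrable_kernel_away:
  fixes u :: "'a::euclidean_space \<Rightarrow> real"
  assumes u: "u \<in> L_space s" and s: "s \<ge> 0" and r: "r > 0"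
    and A: "A \<in> sets lebesgue" and away: "\<And>y. y \<in> A \<Longrightarrow> r \<le> norm (x - y)"
  shows "set_integrable lebesgue A (\<lambda>y. u y / norm (x - y) powr (real DIM('a) + 2 * s))"
proof -
  define p where "p = real DIM('a) + 2 * s"
  have p: "p \<ge> 0" using s by (simp add: p_def)
  define C where "C = 1 / r powr p + (1 + norm x / r) powr p"
  have um[measurable]: "u \<in> borel_measurable lebesgue" using u by (simp add: L_space_def)
  have norm_meas[measurable]: "(\<lambda>y. norm (x - y) powr p) \<in> borel_measurable lebesgue"
    by (rule measurable_completion) measurable
  have "integrable lebesgue (\<lambda>y. C * (\<bar>u y\<bar> / (1 + norm y powr p)))"
    using u by (intro integrable_mult_right) (simp add: L_space_def p_def)
  then have "integrable lebesgue (\<lambda>y. indicator A y *\<^sub>R (u y / norm (x - y) powr p))"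
  proof (rule Bochner_Integration.integrable_bound)
    show "(\<lambda>y. indicator A y *\<^sub>R (u y / norm (x - y) powr p)) \<in> borel_measurable lebesgue"
      using A by measurable
    have C0: "C \<ge> 0" by (simp add: C_def)
    have "norm (indicator A y *\<^sub>R (u y / norm (x - y) powr p))
        \<le> norm (C * (\<bar>u y\<bar> / (1 + norm y powr p)))" for y
    proof (cases "y \<in> A")
      case True
      then have pos: "norm (x - y) powr p > 0" using away[OF True] r by auto
      have one: "1 + norm y powr p > 0" by (simp add: add_pos_nonneg)
      have "\<bar>u y\<bar> * (1 + norm y powr p) \<le> \<bar>u y\<bar> * (C * norm (x - y) powr p)"
        unfolding C_def using away[OF True] p r
        by (intro mult_left_mono one_plus_norm_powr_le) auto
      then have "\<bar>u y\<bar> / norm (x - y) powr p \<le> C * (\<bar>u y\<bar> / (1 + norm y powr p))"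
        using pos one by (simp add: field_simps)
      then show ?thesis using True C0 by (simp add: abs_mult)
    qed simp
    then show "AE y in lebesgue. norm (indicator A y *\<^sub>R (u y / norm (x - y) powr p))
        \<le> norm (C * (\<bar>u y\<bar> / (1 + norm y powr p)))" by simp
  qed
  then show ?thesis by (simp add: set_integrable_def p_def)
qed

section \<open>Growth of the function near an interior zero\<close>

text \<open>The gradient vanishes at the interior minimum, so its Hoelder bound makes it of order
  \<alpha> nearby. The mean value inequality gains one more power of the distance.\<close>

lemma C1_holder_zero_minimum_bound:
  fixes u :: "'a::euclidean_space \<Rightarrow> real"
  assumes u: "u \<in> C1_holder \<Omega> \<alpha>" and \<alpha>: "\<alpha> \<ge> 0" and \<Omega>: "open \<Omega>" and x: "x \<in> \<Omega>"
    and nonneg: "\<And>y. y \<in> \<Omega> \<Longrightarrow> u y \<ge> 0" and zero: "u x = 0"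
  obtains C \<delta> where "0 < \<delta>" "\<delta> \<le> 1" "ball x \<delta> \<subseteq> \<Omega>"
    "\<And>y. y \<in> ball x \<delta> \<Longrightarrow> u y \<le> C * norm (x - y) powr (1 + \<alpha>)"
proof -
  obtain g where g: "\<And>z. z \<in> \<Omega> \<Longrightarrow> GDERIV u z :> g z"
    and holder: "\<And>K. compact K \<Longrightarrow> K \<subseteq> \<Omega> \<Longrightarrow>
        \<exists>C. \<forall>y\<in>K. \<forall>z\<in>K. norm (g y - g z) \<le> C * norm (y - z) powr \<alpha>"
    using u unfolding C1_holder_def mem_Collect_eq by metis
  obtain d where d: "d > 0" "cball x d \<subseteq> \<Omega>" using \<Omega> x open_contains_cball by blast
  \<comment> \<open>The closed ball is the compact set on which the Hoelder condition is applied;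
    the cap at 1 keeps it within the unit ball, where integrability of radial powers is
    known.\<close>
  define \<delta> where "\<delta> = min d 1"
  have \<delta>: "0 < \<delta>" "\<delta> \<le> 1" "cball x \<delta> \<subseteq> \<Omega>" using d by (auto simp: \<delta>_def)
  obtain C where C: "\<And>y z. y \<in> cball x \<delta> \<Longrightarrow> z \<in> cball x \<delta> \<Longrightarrow>
      norm (g y - g z) \<le> C * norm (y - z) powr \<alpha>"
    using holder[OF compact_cball \<delta>(3)] by blast
  have "(\<lambda>h. inner h (g x)) = (\<lambda>h. 0)"
    using differential_zero_maxmin[OF x \<Omega>, of u] g[OF x] nonneg zero by (auto simp: gderiv_def)
  then have gx: "g x = 0" by (metis inner_eq_zero_iff)
  have bound: "u y \<le> \<bar>C\<bar> * norm (x - y) powr (1 + \<alpha>)" if y: "y \<in> ball x \<delta>" for y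
  proof -
    \<comment> \<open>The mean value inequality is applied on the ball reaching exactly to
      \<open>y\<close>: there the gradient is at most
      \<open>\<bar>C\<bar> * \<rho> powr \<alpha>\<close>, whereas the radius \<delta> would give
      only a linear bound on \<open>u\<close>.\<close>
    define \<rho> where "\<rho> = norm (x - y)"
    have sub: "cball x \<rho> \<subseteq> cball x \<delta>" using y by (auto simp: \<rho>_def dist_norm)
    have "norm (u y - u x) \<le> (\<bar>C\<bar> * \<rho> powr \<alpha>) * norm (y - x)"
    proof (rule differentiable_bound[where S = "cball x \<rho>" and f' = "\<lambda>z h. inner h (g z)"])
      fix z assume z: "z \<in> cball x \<rho>"
      then have z': "z \<in> cball x \<delta>" "z \<in> \<Omega>" using sub \<delta> by auto
      show "(u has_derivative (\<lambda>h. inner h (g z))) (at z within cball x \<rho>)"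
        using g[OF z'(2)] by (simp add: gderiv_def has_derivative_at_withinI)
      have "norm (g z) \<le> C * norm (z - x) powr \<alpha>"
        using C[OF z'(1), of x] gx \<delta> by simp
      also have "\<dots> \<le> \<bar>C\<bar> * \<rho> powr \<alpha>"
        using z \<alpha> by (intro mult_mono powr_mono2) (auto simp: dist_norm norm_minus_commute)
      finally have gz: "norm (g z) \<le> \<bar>C\<bar> * \<rho> powr \<alpha>" .
      show "onorm (\<lambda>h. inner h (g z)) \<le> \<bar>C\<bar> * \<rho> powr \<alpha>"
      proof (rule onorm_le)
        fix h
        have "norm (inner h (g z)) \<le> norm h * norm (g z)" by (simp add: Cauchy_Schwarz_ineq2)
        also have "\<dots> \<le> norm h * (\<bar>C\<bar> * \<rho> powr \<alpha>)" using gz by (intro mult_left_mono) auto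
        finally show "norm (inner h (g z)) \<le> \<bar>C\<bar> * \<rho> powr \<alpha> * norm h" by (simp add: mult_ac)
      qed
    qed (auto simp: \<rho>_def dist_norm)
    then show ?thesis
      using zero by (simp add: \<rho>_def powr_add norm_minus_commute mult_ac)
  qed
  show ?thesis by (rule that[OF \<delta>(1,2) _ bound]) (use \<delta> in auto)
qed

section \<open>Sign of the function outside the closure of the domain\<close>

text \<open>If \<open>u x < 0\<close>, the integrand of the normal derivative is at most the
  negative constant \<open>u x / D powr p\<close> on \<Omega>, a set of positive finite measure, so
  the derivative would be negative.\<close>

lemma nonneg_of_nonlocal_normal_deriv:
  fixes u :: "'a::euclidean_space \<Rightarrow> real"
  assumes s: "0 < s" "s < 1" and u: "u \<in> L_space s"
    and \<Omega>: "open \<Omega>" "bounded \<Omega>" "\<Omega> \<noteq> {}"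
    and nonneg: "\<And>y. y \<in> \<Omega> \<Longrightarrow> u y \<ge> 0" and x: "x \<notin> closure \<Omega>"
    and neumann: "nonlocal_normal_deriv s \<Omega> u x \<ge> 0"
  shows "u x \<ge> 0"
proof (rule ccontr)
  assume "\<not> u x \<ge> 0"
  then have ux: "u x < 0" by simp
  define p where "p = real DIM('a) + 2 * s"
  have p: "p \<ge> 0" using s by (simp add: p_def)
  define k where "k = (\<lambda>y. norm (x - y) powr p)"
  have [measurable]: "k \<in> borel_measurable lebesgue"
    unfolding k_def by (rule measurable_completion) measurable
  have \<Omega>_sets[measurable]: "\<Omega> \<in> sets lebesgue" using \<Omega> by auto
  have \<Omega>_fin: "\<Omega> \<in> lmeasurable" using \<Omega> lmeasurable_open by blast
  obtain r where r: "r > 0" "ball x r \<inter> closure \<Omega> = {}"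
    using x by (metis closed_closure open_Compl open_contains_ball disjoint_eq_subset_Compl ComplI)
  have away: "r \<le> norm (x - y)" if "y \<in> \<Omega>" for y
  proof -
    have "y \<notin> ball x r" using that r closure_subset by blast
    then show ?thesis by (simp add: dist_norm)
  qed
  obtain D where D: "\<And>y. y \<in> \<Omega> \<Longrightarrow> norm (x - y) \<le> D" "D > 0"
  proof -
    obtain B where "B > 0" "\<And>y. y \<in> \<Omega> \<Longrightarrow> norm y \<le> B" using \<Omega>(2) bounded_pos by blast
    then have "norm (x - y) \<le> norm x + B" if "y \<in> \<Omega>" for y
      using norm_triangle_ineq4[of x y] that by fastforce
    with \<open>B > 0\<close> that[of "norm x + B"] show ?thesis by (simp add: add_nonneg_pos)
  qed
  have k_low: "r powr p \<le> k y" and k_up: "k y \<le> D powr p" if "y \<in> \<Omega>" for y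
    using away[OF that] D(1)[OF that] r p by (auto simp: k_def intro!: powr_mono2)
  have rp: "r powr p > 0" using r by simp
  have const: "set_integrable lebesgue \<Omega> (\<lambda>y. c :: real)" for c
    using \<Omega>_fin by (simp add: set_integrable_def lmeasurable_iff_integrable)
  \<comment> \<open>A Bochner integral that does not converge is 0 by convention, so the integrand
    must be shown integrable before it is compared with a constant. The distance \<open>r\<close> to
    \<Omega> keeps the kernel bounded.\<close>
  have int1: "set_integrable lebesgue \<Omega> (\<lambda>y. u x / k y)"
  proof (rule set_integrable_bound[OF const[of "\<bar>u x\<bar> / r powr p"]])
    show "set_borel_measurable lebesgue \<Omega> (\<lambda>y. u x / k y)"
      unfolding set_borel_measurable_def by measurable
    show "AE y in lebesgue. y \<in> \<Omega> \<longrightarrow> norm (u x / k y) \<le> norm (\<bar>u x\<bar> / r powr p)"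
    proof (intro AE_I2 impI)
      fix y assume y: "y \<in> \<Omega>"
      have "\<bar>u x\<bar> / k y \<le> \<bar>u x\<bar> / r powr p" using k_low[OF y] rp by (intro frac_le) auto
      then show "norm (u x / k y) \<le> norm (\<bar>u x\<bar> / r powr p)" using k_low[OF y] rp by (simp add: abs_of_pos less_le_trans[OF rp])
    qed
  qed
  have int2: "set_integrable lebesgue \<Omega> (\<lambda>y. u y / k y)"
    unfolding k_def p_def using s by (intro set_integrable_kernel_away[OF u _ r(1) \<Omega>_sets away]) auto
  have int: "set_integrable lebesgue \<Omega> (\<lambda>y. (u x - u y) / k y)"
    using set_integral_diff(1)[OF int1 int2] by (simp add: diff_divide_distrib)
  have "0 \<le> (LINT y:\<Omega>|lebesgue. (u x - u y) / k y)"
    using neumann frac_laplacian_const_pos[OF s, of "DIM('a)"]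
    by (simp add: nonlocal_normal_deriv_def k_def p_def zero_le_mult_iff)
  also have "\<dots> \<le> (LINT y:\<Omega>|lebesgue. u x / D powr p)"
  proof (rule set_integral_mono[OF int const])
    fix y assume y: "y \<in> \<Omega>"
    have ky: "k y > 0" using k_low[OF y] rp by linarith
    have "(u x - u y) / k y \<le> u x / k y" using nonneg[OF y] ky by (simp add: divide_right_mono)
    also have "\<dots> \<le> u x / D powr p"
      using ux k_up[OF y] ky by (intro divide_left_mono_neg mult_pos_pos) auto
    finally show "(u x - u y) / k y \<le> u x / D powr p" .
  qed
  also have "\<dots> = measure lebesgue \<Omega> * (u x / D powr p)"
    using \<Omega>_fin by (simp add: set_lebesgue_integral_def)
  also have "\<dots> < 0"
  proof (rule mult_pos_neg)
    have "\<not> negligible \<Omega>" using \<Omega> open_not_negligible by blast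
    then show "measure lebesgue \<Omega> > 0"
      using \<Omega>_fin by (metis negligible_iff_measure zero_less_measure_iff)
    show "u x / D powr p < 0" using ux D(2) by (simp add: divide_neg_pos)
  qed
  finally show False by simp
qed

section \<open>The fractional Laplacian at an interior zero\<close>

text \<open>The growth bound tames the singularity near \<open>x\<close>, and membership in
  \<open>L_space\<close> handles the rest. Once \<open>h\<close> is integrable, the principal value
  is an ordinary integral by dominated convergence, and \<open>u x = 0\<close> turns the integrand
  into \<open>- h\<close>.\<close>

lemma frac_laplacian_zero_minimum:
  fixes u :: "'a::euclidean_space \<Rightarrow> real"
  assumes s: "0 \<le> s" and \<alpha>: "\<alpha> > 2 * s - 1" "\<alpha> \<ge> 0"
    and u: "u \<in> C1_holder \<Omega> \<alpha>" "u \<in> L_space s"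
    and \<Omega>: "open \<Omega>" "x \<in> \<Omega>"
    and nonneg: "\<And>y. y \<in> \<Omega> \<Longrightarrow> u y \<ge> 0" and zero: "u x = 0"
  defines "h \<equiv> \<lambda>y. u y / norm (x - y) powr (real DIM('a) + 2 * s)"
  shows "integrable lebesgue h"
    and "frac_laplacian s u x = - frac_laplacian_const DIM('a) s * integral\<^sup>L lebesgue h"
proof -
  define p where "p = real DIM('a) + 2 * s"
  have [measurable]: "u \<in> borel_measurable lebesgue" using u by (simp add: L_space_def)
  have [measurable]: "(\<lambda>y. norm (x - y) powr p) \<in> borel_measurable lebesgue"
    by (rule measurable_completion) measurable
  have hm[measurable]: "h \<in> borel_measurable lebesgue" unfolding h_def p_def[symmetric] by measurable
  obtain C \<delta> where \<delta>: "0 < \<delta>" "\<delta> \<le> 1" "ball x \<delta> \<subseteq> \<Omega>"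
    and C: "\<And>y. y \<in> ball x \<delta> \<Longrightarrow> u y \<le> C * norm (x - y) powr (1 + \<alpha>)" 
    using C1_holder_zero_minimum_bound[OF u(1) \<alpha>(2) \<Omega> nonneg zero] by metis
  \<comment> \<open>Dividing the bound of order \<open>1 + \<alpha>\<close> by the kernel's power
    leaves the exponent \<open>q - DIM('a)\<close>, which is integrable at \<open>x\<close> exactly
    because \<open>q > 0\<close>.\<close>
  define q where "q = 1 + \<alpha> - 2 * s"
  have q: "q > 0" using \<alpha> by (simp add: q_def)
  have [measurable]: "ball x r \<in> sets lebesgue" for r by simp
  have "set_integrable lebesgue (ball x \<delta>) (\<lambda>y. C * norm (x - y) powr (q - real DIM('a)))"
    using \<delta> by (intro set_integrable_mult_right
        set_integrable_subset[OF set_integrable_norm_powr_ball[OF q]]) auto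
  then have "set_integrable lebesgue (ball x \<delta>) h"
  proof (rule set_integrable_bound)
    show "set_borel_measurable lebesgue (ball x \<delta>) h"
      unfolding set_borel_measurable_def by measurable
    have "norm (h y) \<le> norm (C * norm (x - y) powr (q - real DIM('a)))" if y: "y \<in> ball x \<delta>" for y
    proof -
      have "h y \<ge> 0" using nonneg y \<delta> by (auto simp: h_def)
      moreover have "h y \<le> C * norm (x - y) powr (1 + \<alpha>) / norm (x - y) powr p"
        unfolding h_def p_def using C[OF y] by (intro divide_right_mono) auto
      moreover have "\<dots> = C * norm (x - y) powr (q - real DIM('a))"
      proof -
        have "q - real DIM('a) = (1 + \<alpha>) - p" by (simp add: p_def q_def)
        then show ?thesis by (simp only: powr_diff times_divide_eq_right)
      qed
      ultimately show ?thesis by simp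
    qed
    then show "AE y in lebesgue. y \<in> ball x \<delta> \<longrightarrow>
        norm (h y) \<le> norm (C * norm (x - y) powr (q - real DIM('a)))" by simp
  qed
  moreover have "set_integrable lebesgue (- ball x \<delta>) h"
    unfolding h_def using \<delta> s by (intro set_integrable_kernel_away[OF u(2)]) (auto simp: dist_norm)
  ultimately have "set_integrable lebesgue (ball x \<delta> \<union> - ball x \<delta>) h"
    by (intro set_integrable_Un) auto
  then show h: "integrable lebesgue h" by (simp add: set_integrable_def)
  have "((\<lambda>r. LINT y:- ball x r|lebesgue. h y) \<longlongrightarrow> integral\<^sup>L lebesgue h) (at_right 0)"
  proof (rule tendsto_at_right_sequentially[OF zero_less_one])
    fix S :: "nat \<Rightarrow> real" assume S: "\<And>n. 0 < S n" "S \<longlonglongrightarrow> 0"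
    show "(\<lambda>n. LINT y:- ball x (S n)|lebesgue. h y) \<longlonglongrightarrow> integral\<^sup>L lebesgue h"
      unfolding set_lebesgue_integral_def
    proof (rule integral_dominated_convergence[where w = "\<lambda>y. norm (h y)"])
      show "AE y in lebesgue. (\<lambda>n. indicator (- ball x (S n)) y *\<^sub>R h y) \<longlonglongrightarrow> h y"
      proof (intro AE_I2 tendsto_eventually)
        fix y
        show "\<forall>\<^sub>F n in sequentially. indicator (- ball x (S n)) y *\<^sub>R h y = h y"
        \<comment> \<open>Every truncation removes \<open>x\<close> itself, but
          \<open>h x = 0\<close>, so the limit is right there too.\<close>
        proof (cases "y = x")
          case False
          then have "\<forall>\<^sub>F n in sequentially. S n < dist x y"
            by (intro order_tendstoD(2)[OF S(2)]) auto
          then show ?thesis by eventually_elim auto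
        qed (simp add: h_def)
      qed
      show "AE y in lebesgue. norm (indicator (- ball x (S n)) y *\<^sub>R h y) \<le> norm (h y)" for n
        by (auto simp: indicator_def)
    qed (use h in \<open>auto intro!: integrable_norm\<close>)
  qed
  then have "((\<lambda>r. - (LINT y:- ball x r|lebesgue. h y)) \<longlongrightarrow> - integral\<^sup>L lebesgue h) (at_right 0)"
    by (rule tendsto_minus)
  from tendsto_Lim[OF _ this] show
    "frac_laplacian s u x = - frac_laplacian_const DIM('a) s * integral\<^sup>L lebesgue h"
    by (simp add: frac_laplacian_def zero h_def set_lebesgue_integral_def)
qed

section \<open>The strong maximum principle on bounded open sets\<close>

text \<open>One zero in \<Omega> forces \<open>u\<close> to vanish almost everywhere in the whole
  space, since the kernel at that zero sees every other point. The sign conditions say nothing on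
  the frontier, which is therefore taken to be negligible.\<close>

theorem strong_maximum_principle:
  fixes u :: "'a::euclidean_space \<Rightarrow> real"
  assumes s: "0 < s" "s < 1" and \<alpha>: "\<alpha> > 2 * s - 1" "\<alpha> \<ge> 0"
    and \<Omega>: "open \<Omega>" "bounded \<Omega>" "negligible (frontier \<Omega>)"
    and u: "u \<in> C1_holder \<Omega> \<alpha>" "u \<in> L_space s"
    and supersol: "\<And>x. x \<in> \<Omega> \<Longrightarrow> frac_laplacian s u x \<ge> 0"
    and nonneg: "\<And>x. x \<in> \<Omega> \<Longrightarrow> u x \<ge> 0"
    and neumann: "\<And>x. x \<notin> closure \<Omega> \<Longrightarrow> nonlocal_normal_deriv s \<Omega> u x \<ge> 0"
  shows "(\<forall>x\<in>\<Omega>. u x > 0) \<or> (AE x in lebesgue. u x = 0)"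
proof (cases "\<forall>x\<in>\<Omega>. u x > 0")
  case False
  with nonneg obtain x where x: "x \<in> \<Omega>" "u x = 0" by force
  define h where "h = (\<lambda>y. u y / norm (x - y) powr (real DIM('a) + 2 * s))"
  have s': "0 \<le> s" using s by simp
  note at_x = frac_laplacian_zero_minimum[OF s' \<alpha> u \<Omega>(1) x(1) nonneg x(2), folded h_def]
  have "AE y in lebesgue. y \<notin> frontier \<Omega>"
    using \<Omega>(3) by (simp add: negligible_iff_null_sets AE_not_in)
  then have h_nonneg: "AE y in lebesgue. 0 \<le> h y"
  proof eventually_elim
    case (elim y)
    have "u y \<ge> 0"
    proof (cases "y \<in> \<Omega>")
      case False
      then have "y \<notin> closure \<Omega>" using elim \<Omega>(1) by (simp add: frontier_def interior_open)
      then show ?thesis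
        using nonneg_of_nonlocal_normal_deriv[OF s u(2) \<Omega>(1,2) _ nonneg] neumann x(1) by blast
    qed (use nonneg in auto)
    then show ?case by (simp add: h_def)
  qed
  have "integral\<^sup>L lebesgue h \<le> 0"
    using supersol[OF x(1)] at_x(2) frac_laplacian_const_pos[OF s, of "DIM('a)"]
    by (simp add: mult_le_0_iff)
  with integral_nonneg_AE[OF h_nonneg] have "integral\<^sup>L lebesgue h = 0" by simp
  then have "AE y in lebesgue. h y = 0"
    using integral_nonneg_eq_0_iff_AE[OF at_x(1) h_nonneg] by simp
  \<comment> \<open>Off \<open>x\<close> the kernel does not vanish, so \<open>h y = 0\<close> gives
    \<open>u y = 0\<close>; at \<open>x\<close> the value is 0 by choice.\<close>
  then have "AE y in lebesgue. u y = 0"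
    by eventually_elim (use x(2) in \<open>auto simp: h_def\<close>)
  then show ?thesis by blast
qed simp

section \<open>Balls and annuli\<close>

lemma annulus_eq: "annulus R\<^sub>0 R = ball 0 R - cball 0 R\<^sub>0"
  by (auto simp: annulus_def)

text \<open>An annulus is not convex in general, but it is a difference of two balls, and frontiers
  of convex sets are negligible.\<close>

lemma negligible_frontier_annulus:
  "negligible (frontier (annulus R\<^sub>0 R :: 'a::euclidean_space set))"
proof (rule negligible_subset)
  show "negligible (frontier (ball (0::'a) R) \<union> frontier (cball (0::'a) R\<^sub>0))"
    by (intro negligible_Un negligible_convex_frontier) auto
  show "frontier (annulus R\<^sub>0 R :: 'a set) \<subseteq> frontier (ball 0 R) \<union> frontier (cball 0 R\<^sub>0)"
    unfolding annulus_eq Diff_eq using frontier_Int_subset frontier_complement by fast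
qed

theorem theorem2p6:
  fixes s \<epsilon> :: real
    and \<Omega> :: "(real ^ 'n) set"
    and u :: "real ^ 'n \<Rightarrow> real"
  assumes s: "1/2 < s" "s < 1"
    and Omega: "(\<exists>R>0. \<Omega> = ball 0 R) \<or> (\<exists>R\<^sub>0 R. 0 < R\<^sub>0 \<and> R\<^sub>0 < R \<and> \<Omega> = annulus R\<^sub>0 R)"
    and eps: "\<epsilon> > 0"
    and u: "u \<in> C1_holder \<Omega> (2 * s + \<epsilon> - 1) \<inter> L_space s"
    and supersol: "\<forall>x\<in>\<Omega>. frac_laplacian s u x \<ge> 0"
    and nonneg: "\<forall>x\<in>\<Omega>. u x \<ge> 0"
    and neumann: "\<forall>x\<in>- closure \<Omega>. nonlocal_normal_deriv s \<Omega> u x \<ge> 0"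
  shows "(AE x\<in>\<Omega> in lebesgue. u x > 0) \<or> (AE x\<in>\<Omega> in lebesgue. u x = 0)"
proof -
  have \<Omega>: "open \<Omega>" "bounded \<Omega>" "negligible (frontier \<Omega>)"
    using Omega negligible_frontier_annulus negligible_convex_frontier[OF convex_ball]
    by (auto simp: annulus_eq open_Diff bounded_diff)
  \<comment> \<open>Here \<open>\<epsilon> > 0\<close> gives the gain over \<open>2 * s - 1\<close>,
    and \<open>s > 1/2\<close> makes the exponent nonnegative.\<close>
  have \<alpha>: "2 * s + \<epsilon> - 1 > 2 * s - 1" "2 * s + \<epsilon> - 1 \<ge> 0" using s eps by auto
  have "(\<forall>x\<in>\<Omega>. u x > 0) \<or> (AE x in lebesgue. u x = 0)"
    by (rule strong_maximum_principle[OF _ s(2) \<alpha> \<Omega>]) (use assms in auto)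
  then show ?thesis
  proof
    assume "AE x in lebesgue. u x = 0"
    then show ?thesis by (intro disjI2) (auto elim: eventually_mono)
  qed simp
qed

end
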